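(* The generating function for the distribution of the first letter statistic on $\mathcal{S}_n(1243,1423)$ for $n\ge1$ is given by $$\sum_{n\ge1}\ \sum_{\pi\in\mathcal{S}_n(1243,1423)}v^{\pi_1}x^n=\frac{vx(2-3v-3x+3vx)+vx(v+x-vx)\left(vx+\sqrt{1-6vx+v^2x^2}\right)}{2(1-v-2x+vx)}.$$
   Context: $\mathcal{S}_n(\sigma,\tau)$ is the set of permutations $\pi=\pi_1\cdots\pi_n$ of $[n]$ avoiding both patterns $\sigma$ and $\tau$ (classical pattern avoidance). The first letter statistic is $\pi_1$. The identity is between formal power series in $x$ with coefficients rational functions of $v$; the square root is the power series with constant term $1$. *)

theory Defs
  imports
    "HOL-Computational_Algebra.Computational_Algebra"
    "HOL-Combinatorics.Multiset_Permutations"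
    "HOL-Library.Sublist"
begin

definition order_isomorphic :: "nat list \<Rightarrow> nat list \<Rightarrow> bool" where
  "order_isomorphic xs ys \<longleftrightarrow> length xs = length ys \<and>
     (\<forall>i<length xs. \<forall>j<length xs. xs ! i < xs ! j \<longleftrightarrow> ys ! i < ys ! j)"

text \<open>Here \<open>subseq\<close> is the not necessarily contiguous subsequence relation, so this is
  classical pattern containment.\<close>

definition contains_pattern :: "nat list \<Rightarrow> nat list \<Rightarrow> bool" where
  "contains_pattern \<pi> \<sigma> \<longleftrightarrow> (\<exists>\<rho>. subseq \<rho> \<pi> \<and> order_isomorphic \<rho> \<sigma>)"

text \<open>Permutations of \<open>[n]\<close> are in one-line notation; \<open>permutations_of_set A\<close> is the set of
  lists that enumerate \<open>A\<close> without repetition, and the first letter of \<open>\<pi>\<close> is \<open>hd \<pi>\<close>.\<close>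

definition avoiders :: "nat \<Rightarrow> nat list \<Rightarrow> nat list \<Rightarrow> nat list set" where
  "avoiders n \<sigma> \<tau> =
     {\<pi> \<in> permutations_of_set {1..n}. \<not> contains_pattern \<pi> \<sigma> \<and> \<not> contains_pattern \<pi> \<tau>}"

text \<open>The field of rational functions in \<open>v\<close> is \<open>rat poly fract\<close>, and
  \<open>ratfun_v\<close> is its indeterminate.\<close>

definition ratfun_v :: "rat poly fract" where
  "ratfun_v = to_fract [:0, 1:]"

abbreviation V :: "rat poly fract fps" where
  "V \<equiv> fps_const ratfun_v"

abbreviation X :: "rat poly fract fps" where
  "X \<equiv> fps_X"

text \<open>The coefficient of \<open>x\<^sup>0\<close> is zero because the sum starts at \<open>n = 1\<close>.\<close>

definition first_letter_gf :: "nat list \<Rightarrow> nat list \<Rightarrow> rat poly fract fps" where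
  "first_letter_gf \<sigma> \<tau> =
     Abs_fps (\<lambda>n. if n \<ge> 1 then \<Sum>\<pi>\<in>avoiders n \<sigma> \<tau>. ratfun_v ^ hd \<pi> else 0)"

definition fps_sqrt :: "'a :: field_char_0 fps \<Rightarrow> 'a fps" where
  "fps_sqrt a = (THE s. s ^ 2 = a \<and> fps_nth s 0 = 1)"

lemma ex1_fps_sqrt:
  fixes a :: "'a :: field_char_0 fps"
  assumes "fps_nth a 0 = 1"
  shows "\<exists>!s. s ^ 2 = a \<and> fps_nth s 0 = 1"
proof (rule ex1I)
  let ?r = "fps_radical (\<lambda>_ _. 1) 2 a"
  have "?r ^ 2 = a"
    using power_radical[of a "\<lambda>_ _. 1" 1] assms by (simp add: numeral_2_eq_2)
  then show "?r ^ 2 = a \<and> fps_nth ?r 0 = 1"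
    by simp
  fix s assume s: "s ^ 2 = a \<and> fps_nth s 0 = 1"
  have "(s - ?r) * (s + ?r) = s ^ 2 - ?r ^ 2"
    by (simp add: power2_eq_square algebra_simps)
  also have "\<dots> = 0"
    using s \<open>?r ^ 2 = a\<close> by simp
  finally have "s - ?r = 0 \<or> s + ?r = 0"
    by simp
  moreover have "fps_nth (s + ?r) 0 \<noteq> 0"
    using s by simp
  then have "s + ?r \<noteq> 0"
    by (metis fps_zero_nth)
  ultimately show "s = ?r"
    by simp
qed

lemma fps_sqrt:
  fixes a :: "'a :: field_char_0 fps"
  assumes "fps_nth a 0 = 1"
  shows "fps_sqrt a ^ 2 = a" "fps_nth (fps_sqrt a) 0 = 1"
  using theI'[OF ex1_fps_sqrt[OF assms]] unfolding fps_sqrt_def by auto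

end

theory Submission
  imports Defs
begin

text \<open>Let \<open>a(n, k)\<close> be the number of avoiders of length \<open>n\<close> with first letter \<open>k\<close>. Look at the
  second letter \<open>j\<close> of such a permutation. If \<open>j < k\<close>, then \<open>k\<close> is in no forbidden pattern that
  \<open>j\<close> could not start in its place, so \<open>k\<close> can be deleted and what remains is an arbitrary
  shorter avoider that begins with \<open>j\<close>. If \<open>j > k\<close>, then \<open>j\<close> can be deleted. To undo this, note
  that the letters above \<open>k\<close> form a word in which each letter is a left-to-right maximum or
  minimum, and a new first letter of that word has to be adjacent in value to the old first letter;
  this leaves two choices, or one if there was no letter above \<open>k\<close>. Hence, for \<open>n \<ge> 1\<close> and
  \<open>1 \<le> k \<le> n + 1\<close>, \<open>a(n + 1, k) = a(n, 1) + \<dots> + a(n, k - 1) + m a(n, k)\<close>, where \<open>m = 1\<close> for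
  \<open>k = n\<close> and \<open>m = 2\<close> otherwise (\<open>first_letter_count_Suc\<close>).

  Summed against \<open>v\<^bsup>k\<^esup> x\<^bsup>n\<^esup>\<close>, the recurrence becomes
  \<open>(1 - v - 2 x + v x) G = v x - (v + x - v x) E\<close>, where \<open>G\<close> is the wanted generating function and
  \<open>E = \<Sum> a(n, n) v\<^bsup>n\<^esup> x\<^bsup>n\<^esup>\<close> (\<open>kernel_equation\<close>). It remains to find \<open>E\<close>. The kernel
  method suggests that with \<open>t = v x\<close> the generating function of each diagonal
  \<open>n - k = d\<close> of the triangle is \<open>E\<close> times \<open>2\<^bsup>d-1\<^esup> \<eta>\<^bsup>d\<^esup>\<close> (for \<open>d \<ge> 1\<close>), where
  \<open>\<eta>\<close> is the series of the little Schroeder numbers and \<open>E = t / (1 - t \<eta>)\<close>. This is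
  verified by induction along the recurrence (\<open>first_letter_count_eq_diagonal_gf\<close>), with no
  substitution into the kernel. Finally \<open>2 E = t (3 - t - R)\<close> with
  \<open>R\<^sup>2 = 1 - 6 t + t\<^sup>2\<close> (\<open>diagonal_gf_0_eq\<close>) turns the kernel equation into the formula
  of the theorem.\<close>

section \<open>Inserting letters at the front of an avoiding word\<close>

text \<open>The patterns 1243 and 1423 differ only in the order of their middle letters, so a word avoids
  both exactly when no letter \<open>c\<close> has, somewhere before it, two letters with \<open>c\<close> strictly
  between them in value and, before these, a letter smaller than both. Treating the two patterns
  together in this way makes every argument below symmetric in the two middle letters.\<close>

definition between :: "nat \<Rightarrow> nat \<Rightarrow> nat \<Rightarrow> bool" where
  "between c p q \<longleftrightarrow> p < c \<and> c < q \<or> q < c \<and> c < p"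

text \<open>In a word without repeated letters this says that every letter is a left-to-right maximum or a
  left-to-right minimum.\<close>

definition avoids_132_312 :: "nat list \<Rightarrow> bool" where
  "avoids_132_312 u \<longleftrightarrow> (\<forall>p q c. subseq [p, q, c] u \<longrightarrow> \<not> between c p q)"

definition avoids_1243_1423 :: "nat list \<Rightarrow> bool" where
  "avoids_1243_1423 w \<longleftrightarrow> (\<forall>a p q c. subseq [a, p, q, c] w \<longrightarrow> a < p \<longrightarrow> a < q \<longrightarrow> \<not> between c p q)"

text \<open>The existential over subsequences becomes one over four letters, so that \<open>order_isomorphic\<close>
  can be evaluated by cases on the positions.\<close>

lemma contains_pattern_four:
  "contains_pattern \<pi> [r, s, t, u] \<longleftrightarrow>
     (\<exists>a b c d. subseq [a, b, c, d] \<pi> \<and> order_isomorphic [a, b, c, d] [r, s, t, u])"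
proof
  assume "contains_pattern \<pi> [r, s, t, u]"
  then obtain \<rho> where \<rho>: "subseq \<rho> \<pi>" "order_isomorphic \<rho> [r, s, t, u]"
    unfolding contains_pattern_def by blast
  then have "length \<rho> = Suc (Suc (Suc (Suc 0)))"
    by (simp add: order_isomorphic_def)
  then obtain a b c d where "\<rho> = [a, b, c, d]"
    by (auto simp: length_Suc_conv)
  with \<rho> show "\<exists>a b c d. subseq [a, b, c, d] \<pi> \<and> order_isomorphic [a, b, c, d] [r, s, t, u]"
    by blast
qed (auto simp: contains_pattern_def)

lemma order_isomorphic_four:
  "order_isomorphic [a, b, c, d] [r, s, t, u] \<longleftrightarrow>
     ((a < b \<longleftrightarrow> r < s) \<and> (a < c \<longleftrightarrow> r < t) \<and> (a < d \<longleftrightarrow> r < u)) \<and>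
     ((b < a \<longleftrightarrow> s < r) \<and> (b < c \<longleftrightarrow> s < t) \<and> (b < d \<longleftrightarrow> s < u)) \<and>
     ((c < a \<longleftrightarrow> t < r) \<and> (c < b \<longleftrightarrow> t < s) \<and> (c < d \<longleftrightarrow> t < u)) \<and>
     ((d < a \<longleftrightarrow> u < r) \<and> (d < b \<longleftrightarrow> u < s) \<and> (d < c \<longleftrightarrow> u < t))"
  by (simp add: order_isomorphic_def All_less_Suc conj_ac)

lemma order_isomorphic_1243:
  "order_isomorphic [a, b, c, d] [1, 2, 4, 3] \<longleftrightarrow> a < b \<and> b < d \<and> d < c"
  unfolding order_isomorphic_four by simp linarith

lemma order_isomorphic_1423:
  "order_isomorphic [a, b, c, d] [1, 4, 2, 3] \<longleftrightarrow> a < c \<and> c < d \<and> d < b"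
  unfolding order_isomorphic_four by simp linarith

lemma avoids_1243_1423_iff:
  "avoids_1243_1423 \<pi> \<longleftrightarrow> \<not> contains_pattern \<pi> [1, 2, 4, 3] \<and> \<not> contains_pattern \<pi> [1, 4, 2, 3]"
  unfolding contains_pattern_four order_isomorphic_1243 order_isomorphic_1423
  unfolding avoids_1243_1423_def between_def by (meson less_trans)

lemma subseq_Cons_iff:
  "subseq (x # xs) (y # ys) \<longleftrightarrow> x = y \<and> subseq xs ys \<or> subseq (x # xs) ys"
  by (auto dest: subseq_Cons')

lemma subseq_filter_iff:
  "subseq xs (filter P ys) \<longleftrightarrow> subseq xs ys \<and> (\<forall>x\<in>set xs. P x)"
proof
  assume *: "subseq xs (filter P ys)"
  have "P x" if "x \<in> set xs" for x
    using list_emb_set[OF * that] by auto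
  then show "subseq xs ys \<and> (\<forall>x\<in>set xs. P x)"
    using * subseq_filter_left subseq_order.trans by blast
next
  assume "subseq xs ys \<and> (\<forall>x\<in>set xs. P x)"
  then show "subseq xs (filter P ys)"
    using subseq_filter[of xs ys P] by (simp add: filter_id_conv[THEN iffD2])
qed

lemma avoids_132_312_subseq: "avoids_132_312 ys \<Longrightarrow> subseq xs ys \<Longrightarrow> avoids_132_312 xs"
  unfolding avoids_132_312_def by (meson subseq_order.trans)

text \<open>A forbidden occurrence either starts at \<open>k\<close> or lies in \<open>w\<close>; with \<open>k\<close> as its smallest
  letter, the remaining three letters form a 132 or a 312 among the letters above \<open>k\<close>.\<close>

lemma avoids_1243_1423_Cons:
  "avoids_1243_1423 (k # w) \<longleftrightarrow>
    avoids_1243_1423 w \<and> avoids_132_312 (filter (\<lambda>x. k < x) w)"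
proof -
  have "between c p q \<Longrightarrow> k < p \<Longrightarrow> k < q \<Longrightarrow> k < c" for c p q
    by (auto simp: between_def)
  then show ?thesis
    unfolding avoids_1243_1423_def avoids_132_312_def subseq_filter_iff subseq_Cons_iff
    by (simp; blast)
qed

text \<open>Suppose that \<open>j\<close> and a later \<open>q\<close> enclose \<open>c\<close> in value. Since \<open>f\<close> and \<open>q\<close> do not enclose
  \<open>c\<close>, the letter \<open>f\<close> is on the same side of \<open>c\<close> as \<open>q\<close>, so that \<open>j\<close> and \<open>f\<close> already
  enclose \<open>c\<close>. Hence a new first letter has to be tested only against the old first letter.\<close>

lemma avoids_132_312_Cons_Cons:
  assumes "distinct (j # f # L)"
  shows "avoids_132_312 (j # f # L) \<longleftrightarrow> avoids_132_312 (f # L) \<and> (\<forall>c\<in>set L. \<not> between c j f)"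
proof
  assume sf: "avoids_132_312 (j # f # L)"
  have "\<not> between c j f" if "c \<in> set L" for c
  proof -
    have "subseq [j, f, c] (j # f # L)"
      using that by (simp add: subseq_singleton_left)
    then show ?thesis
      using sf unfolding avoids_132_312_def by blast
  qed
  moreover have "avoids_132_312 (f # L)"
    using avoids_132_312_subseq[OF sf] by (meson list_emb_Cons subseq_order.refl)
  ultimately show "avoids_132_312 (f # L) \<and> (\<forall>c\<in>set L. \<not> between c j f)"
    by blast
next
  assume *: "avoids_132_312 (f # L) \<and> (\<forall>c\<in>set L. \<not> between c j f)"
  have "\<not> between c j q" if "subseq [q, c] (f # L)" for q c
  proof (cases "q = f")
    case True
    then have "c \<in> set L"
      using that by (simp add: subseq_singleton_left)
    then show ?thesis using True * by simp
  next
    case False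
    then have qc: "subseq [q, c] L"
      using that by simp
    then have "q \<in> set L" "c \<in> set L"
      using list_emb_set[OF qc] by auto
    moreover have "\<not> between c f q"
      using * qc unfolding avoids_132_312_def by (metis subseq_Cons2)
    ultimately show ?thesis
      using * assms unfolding between_def by (metis distinct.simps(2) linorder_neqE_nat)
  qed
  then show "avoids_132_312 (j # f # L)"
    using * unfolding avoids_132_312_def subseq_Cons_iff[of _ _ j] by metis
qed

lemma avoids_132_312_singleton: "avoids_132_312 [j]"
  by (auto simp: avoids_132_312_def)

text \<open>An occurrence that starts at \<open>k\<close> can be started at the smaller \<open>j\<close> instead: its other letters
  exceed \<open>k\<close>, hence none of them is \<open>j\<close>.\<close>

lemma avoids_1243_1423_Cons_descent:
  assumes "j < k"
  shows "avoids_1243_1423 (k # j # w) \<longleftrightarrow> avoids_1243_1423 (j # w)"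
proof -
  have "subseq (filter (\<lambda>x. k < x) w) (filter (\<lambda>x. j < x) w)"
    using assms by (auto simp: subseq_filter_iff)
  then show ?thesis
    using assms avoids_132_312_subseq by (auto simp: avoids_1243_1423_Cons)
qed

text \<open>An occurrence that starts at \<open>j\<close> can be started at the smaller \<open>k\<close> instead, so the only effect
  of inserting \<open>j\<close> right after \<open>k\<close> is on the word of letters above \<open>k\<close>.\<close>

lemma avoids_1243_1423_Cons_ascent:
  assumes "k < j"
  shows "avoids_1243_1423 (k # j # w) \<longleftrightarrow> avoids_1243_1423 (k # w) \<and> avoids_132_312 (j # filter (\<lambda>x. k < x) w)"
proof -
  have "subseq (filter (\<lambda>x. j < x) w) (filter (\<lambda>x. k < x) w)"
    using assms by (auto simp: subseq_filter_iff)
  moreover have "subseq (filter (\<lambda>x. k < x) w) (j # filter (\<lambda>x. k < x) w)"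
    by auto
  ultimately show ?thesis
    using assms avoids_132_312_subseq by (auto simp: avoids_1243_1423_Cons)
qed

lemma avoids_1243_1423_map:
  assumes "strict_mono h"
  shows "avoids_1243_1423 (map h w) \<longleftrightarrow> avoids_1243_1423 w"
proof -
  have lt: "h x < h y \<longleftrightarrow> x < y" for x y
    using assms by (rule strict_mono_less)
  have sub: "subseq (map h xs) (map h w) \<longleftrightarrow> subseq xs w" for xs
  proof
    assume "subseq (map h xs) (map h w)"
    then have "subseq (map (inv h) (map h xs)) (map (inv h) (map h w))"
      by (rule subseq_map)
    then show "subseq xs w"
      using strict_mono_imp_inj_on[OF assms] by (simp add: comp_def)
  qed (rule subseq_map)
  show ?thesis
  proof
    assume w: "avoids_1243_1423 (map h w)"
    show "avoids_1243_1423 w"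
      unfolding avoids_1243_1423_def
    proof (intro allI impI)
      fix a p q c assume "subseq [a, p, q, c] w" "a < p" "a < q"
      then have "subseq [h a, h p, h q, h c] (map h w)" "h a < h p" "h a < h q"
        using sub[of "[a, p, q, c]"] by (simp_all add: lt)
      then have "\<not> between (h c) (h p) (h q)"
        using w unfolding avoids_1243_1423_def by blast
      then show "\<not> between c p q"
        by (simp add: between_def lt)
    qed
  next
    assume w: "avoids_1243_1423 w"
    show "avoids_1243_1423 (map h w)"
      unfolding avoids_1243_1423_def
    proof (intro allI impI)
      fix a p q c assume s: "subseq [a, p, q, c] (map h w)" and less: "a < p" "a < q"
      have "\<exists>y. x = h y" if "x \<in> {a, p, q, c}" for x
        using list_emb_set[OF s, of x] that by auto
      then obtain a' p' q' c' where h: "a = h a'" "p = h p'" "q = h q'" "c = h c'"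
        by (meson insertI1 insertI2)
      have "subseq [a', p', q', c'] w"
        using s sub[of "[a', p', q', c']"] by (simp add: h)
      then have "\<not> between c' p' q'"
        using w less unfolding avoids_1243_1423_def h lt by blast
      then show "\<not> between c p q"
        by (simp add: between_def h lt)
    qed
  qed
qed

section \<open>Relabelling permutations\<close>

text \<open>The order isomorphism from the naturals onto the naturals other than \<open>j\<close>: it makes room for the
  letter \<open>j\<close> in a permutation.\<close>

definition up :: "nat \<Rightarrow> nat \<Rightarrow> nat" where
  "up j x = (if x < j then x else Suc x)"

lemma up_less_iff [simp]: "up j x < up j y \<longleftrightarrow> x < y"
  by (auto simp: up_def)

lemma strict_mono_up: "strict_mono (up j)"
  by (rule strict_monoI) simp

lemma up_eq_iff [simp]: "up j x = up j y \<longleftrightarrow> x = y"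
  by (auto simp: up_def split: if_splits)

lemma inj_up: "inj_on (up j) A"
  by (rule inj_onI) simp

lemma up_neq [simp]: "up j x \<noteq> j" "j \<noteq> up j x"
  by (auto simp: up_def)

lemma up_image:
  assumes "1 \<le> j" "j \<le> Suc n"
  shows "up j ` {1..n} = {1..Suc n} - {j}"
proof (rule card_seteq[symmetric, THEN sym])
  show "up j ` {1..n} \<subseteq> {1..Suc n} - {j}"
    by (auto simp: up_def)
  show "card ({1..Suc n} - {j}) \<le> card (up j ` {1..n})"
    using assms by (simp add: card_image[OF inj_up] card_Diff_singleton)
qed simp

definition is_perm :: "nat \<Rightarrow> nat list \<Rightarrow> bool" where
  "is_perm n w \<longleftrightarrow> distinct w \<and> set w = {1..n}"

lemma is_perm_Suc_Cons:
  "is_perm (Suc n) (j # w) \<longleftrightarrow> 1 \<le> j \<and> j \<le> Suc n \<and> (\<exists>u. w = map (up j) u \<and> is_perm n u)"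
proof
  assume p: "is_perm (Suc n) (j # w)"
  then have j: "1 \<le> j" "j \<le> Suc n"
    by (auto simp: is_perm_def)
  have w: "set w = up j ` {1..n}" "distinct w"
    using p unfolding up_image[OF j] by (auto simp: is_perm_def)
  then obtain u where u: "w = map (up j) u"
    by (metis ex_map_conv imageE)
  with w have "is_perm n u"
    by (simp add: is_perm_def distinct_map inj_image_eq_iff[OF inj_up])
  with j u show "1 \<le> j \<and> j \<le> Suc n \<and> (\<exists>u. w = map (up j) u \<and> is_perm n u)"
    by blast
next
  assume *: "1 \<le> j \<and> j \<le> Suc n \<and> (\<exists>u. w = map (up j) u \<and> is_perm n u)"
  then obtain u where u: "w = map (up j) u" "is_perm n u"
    by blast
  then have "set w = {1..Suc n} - {j}" "distinct w"
    using * up_image by (auto simp: is_perm_def distinct_map inj_up)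
  then show "is_perm (Suc n) (j # w)"
    using * by (auto simp: is_perm_def)
qed

section \<open>Recurrence for the number of avoiders with a given first letter\<close>

text \<open>The avoiders of length \<open>n\<close> that begin with \<open>k\<close>, represented by what follows the \<open>k\<close>, because
  the bijections below insert letters right after it.\<close>

definition tails :: "nat \<Rightarrow> nat \<Rightarrow> nat list set" where
  "tails n k = {w. is_perm n (k # w) \<and> avoids_1243_1423 (k # w)}"

lemma finite_tails: "finite (tails n k)"
proof (rule finite_subset)
  show "tails n k \<subseteq> {w. set w \<subseteq> {1..n} \<and> length w \<le> n}"
  proof
    fix w assume "w \<in> tails n k"
    then have p: "distinct (k # w)" "set (k # w) = {1..n}"
      by (auto simp: tails_def is_perm_def)
    then have "length (k # w) = n"
      using distinct_card[OF p(1)] by simp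
    with p show "w \<in> {w. set w \<subseteq> {1..n} \<and> length w \<le> n}"
      by auto
  qed
qed (rule finite_lists_length_le, simp)

text \<open>For permutations of length at least two, \<open>w\<close> is nonempty and \<open>hd w\<close> is the second letter.\<close>

definition descent_tails :: "nat \<Rightarrow> nat \<Rightarrow> nat list set" where
  "descent_tails n k = {w \<in> tails n k. hd w < k}"

definition ascent_tails :: "nat \<Rightarrow> nat \<Rightarrow> nat list set" where
  "ascent_tails n k = {w \<in> tails n k. k < hd w}"

text \<open>Deleting the first letter \<open>k\<close> and closing the gap in the values leaves an arbitrary avoider that
  begins with some \<open>j < k\<close>.\<close>

lemma descent_tails_eq:
  assumes "1 \<le> n" "1 \<le> k" "k \<le> Suc n"
  shows "descent_tails (Suc n) k = (\<Union>j\<in>{1..<k}. (\<lambda>u. map (up k) (j # u)) ` tails n j)"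
proof (intro equalityI subsetI)
  fix w assume w: "w \<in> descent_tails (Suc n) k"
  then obtain v where v: "w = map (up k) v" "is_perm n v" and g: "avoids_1243_1423 (k # w)" and lt: "hd w < k"
    by (auto simp: descent_tails_def tails_def is_perm_Suc_Cons)
  obtain j u where ju: "v = j # u"
    using v assms by (cases v) (auto simp: is_perm_def)
  have "up k j < k"
    using lt v ju by simp
  then have j: "j < k" "up k j = j"
    by (auto simp: up_def split: if_splits)
  have "avoids_1243_1423 (map (up k) v)"
    using g avoids_1243_1423_Cons_descent[of j k] v ju j by simp
  then have "u \<in> tails n j"
    using v ju avoids_1243_1423_map[OF strict_mono_up, of k "j # u"] by (simp add: tails_def)
  moreover have "1 \<le> j"
    using v ju by (auto simp: is_perm_def)
  ultimately show "w \<in> (\<Union>j\<in>{1..<k}. (\<lambda>u. map (up k) (j # u)) ` tails n j)"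
    using v(1) ju j by (intro UN_I[of j] image_eqI[of _ _ u]) auto
next
  fix w assume "w \<in> (\<Union>j\<in>{1..<k}. (\<lambda>u. map (up k) (j # u)) ` tails n j)"
  then obtain j u where j: "1 \<le> j" "j < k" and u: "u \<in> tails n j" and w: "w = map (up k) (j # u)"
    by auto
  have "up k j = j"
    using j by (simp add: up_def)
  moreover have "avoids_1243_1423 w"
    unfolding w using u avoids_1243_1423_map[OF strict_mono_up] by (simp add: tails_def del: list.map)
  ultimately have "avoids_1243_1423 (k # w)"
    using avoids_1243_1423_Cons_descent[of j k] j w by simp
  moreover have "is_perm (Suc n) (k # w)"
    using u w assms unfolding is_perm_Suc_Cons tails_def by blast
  ultimately show "w \<in> descent_tails (Suc n) k"
    using w j \<open>up k j = j\<close> by (simp add: descent_tails_def tails_def)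
qed

lemma card_descent_tails:
  assumes "1 \<le> n" "1 \<le> k" "k \<le> Suc n"
  shows "card (descent_tails (Suc n) k) = (\<Sum>j\<in>{1..<k}. card (tails n j))"
proof -
  have "card (descent_tails (Suc n) k)
      = (\<Sum>j\<in>{1..<k}. card ((\<lambda>u. map (up k) (j # u)) ` tails n j))"
    unfolding descent_tails_eq[OF assms]
    by (rule card_UN_disjoint) (auto simp: finite_tails)
  also have "\<dots> = (\<Sum>j\<in>{1..<k}. card (tails n j))"
    by (intro sum.cong refl card_image inj_onI) (auto dest: map_injective simp: inj_up)
  finally show ?thesis .
qed

text \<open>Since \<open>j > k\<close>, relabelling around \<open>j\<close> keeps the first letter \<open>k\<close> fixed.\<close>

lemma is_perm_Cons_Cons_ascent:
  assumes "k < j"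
  shows "is_perm (Suc n) (k # j # w) \<longleftrightarrow>
     j \<le> Suc n \<and> (\<exists>u. w = map (up j) u \<and> is_perm n (k # u))"
proof -
  have up: "up j x = k \<longleftrightarrow> x = k" for x
    using assms by (auto simp: up_def)
  have "is_perm (Suc n) (k # j # w) \<longleftrightarrow> is_perm (Suc n) (j # k # w)"
    by (auto simp: is_perm_def)
  also have "\<dots> \<longleftrightarrow> 1 \<le> j \<and> j \<le> Suc n \<and> (\<exists>u. k # w = map (up j) u \<and> is_perm n u)"
    by (rule is_perm_Suc_Cons)
  also have "(\<exists>u. k # w = map (up j) u \<and> is_perm n u) \<longleftrightarrow>
      (\<exists>u. w = map (up j) u \<and> is_perm n (k # u))" (is "?l \<longleftrightarrow> ?r")
  proof
    assume ?l
    then obtain k' u where "k = up j k'" "w = map (up j) u" "is_perm n (k' # u)"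
      by (auto simp: Cons_eq_map_conv)
    then show ?r
      using up[of k'] by auto
  next
    assume ?r
    then obtain u where "w = map (up j) u" "is_perm n (k # u)"
      by blast
    then have "k # w = map (up j) (k # u) \<and> is_perm n (k # u)"
      using up[of k] by simp
    then show ?l
      by (rule exI[of _ "k # u"])
  qed
  finally show ?thesis
    using assms by auto
qed

lemma filter_map_up:
  assumes "k < j"
  shows "filter (\<lambda>x. k < x) (map (up j) u) = map (up j) (filter (\<lambda>x. k < x) u)"
proof -
  have "k < up j x \<longleftrightarrow> k < x" for x
    using assms by (auto simp: up_def)
  then show ?thesis
    by (simp add: filter_map comp_def)
qed

lemma ascent_tails_iff:
  assumes "k < j"
  shows "j # map (up j) u \<in> ascent_tails (Suc n) k \<longleftrightarrow>
    j \<le> Suc n \<and> u \<in> tails n k \<and> avoids_132_312 (j # map (up j) (filter (\<lambda>x. k < x) u))"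
proof -
  have "is_perm (Suc n) (k # j # map (up j) u) \<longleftrightarrow> j \<le> Suc n \<and> is_perm n (k # u)"
    unfolding is_perm_Cons_Cons_ascent[OF assms]
    by (auto dest: map_injective simp: inj_up)
  moreover have "avoids_1243_1423 (k # map (up j) u) \<longleftrightarrow> avoids_1243_1423 (k # u)"
  proof -
    have "k # map (up j) u = map (up j) (k # u)"
      using assms by (simp add: up_def)
    then show ?thesis
      using avoids_1243_1423_map[OF strict_mono_up] by metis
  qed
  ultimately show ?thesis
    using assms by (auto simp: ascent_tails_def tails_def avoids_1243_1423_Cons_ascent filter_map_up)
qed

lemma ascent_tailsE:
  assumes "w \<in> ascent_tails (Suc n) k" "1 \<le> n"
  obtains j u where "w = j # map (up j) u" "k < j" "j \<le> Suc n" "u \<in> tails n k"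
proof -
  have p: "is_perm (Suc n) (k # w)" and lt: "k < hd w"
    using assms by (auto simp: ascent_tails_def tails_def)
  have "w \<noteq> []"
  proof
    assume "w = []"
    then have "{k} = {1..Suc n}"
      using p by (simp add: is_perm_def)
    then have "card {1..Suc n} = 1"
      by (metis card_1_singleton_iff One_nat_def)
    then show False
      using assms by simp
  qed
  then obtain j v where w: "w = j # v"
    by (cases w) auto
  then have j: "k < j"
    using lt by simp
  then obtain u where u: "j \<le> Suc n" "v = map (up j) u" "is_perm n (k # u)"
    using p w is_perm_Cons_Cons_ascent by blast
  then show ?thesis
    using that[of j u] ascent_tails_iff[OF j, of u n] assms w j by blast
qed

text \<open>The letters after \<open>k\<close> and above it are all of \<open>k + 1, \<dots>, n\<close>, starting with \<open>f\<close>. By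
  \<open>avoids_132_312_Cons_Cons\<close>, the new letter \<open>j\<close> must have no value between itself and the
  relabelled \<open>f\<close>. As no value is missing, this leaves only the position directly below the old
  first letter (\<open>j = f\<close>, which pushes \<open>f\<close> to \<open>f + 1\<close>) and the one directly above it.\<close>

lemma avoids_132_312_reinsert_iff:
  assumes "is_perm n (k # u)" "filter (\<lambda>x. k < x) u = f # L" "avoids_1243_1423 (k # u)" "k < j" "j \<le> Suc n"
  shows "avoids_132_312 (j # map (up j) (filter (\<lambda>x. k < x) u)) \<longleftrightarrow> j = f \<or> j = Suc f"
proof -
  have set: "set (f # L) = {Suc k..n}"
  proof -
    have "set (f # L) = {x \<in> set (k # u). k < x}"
      using assms(2) by (metis filter.simps(2) less_irrefl set_filter)
    also have "\<dots> = {Suc k..n}"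
      using assms(1) by (auto simp: is_perm_def)
    finally show ?thesis .
  qed
  have dist: "distinct (f # L)"
    using assms(1) unfolding assms(2)[symmetric] by (simp add: is_perm_def)
  have L: "set L = {Suc k..n} - {f}"
    using set dist by auto
  have f: "k < f" "f \<le> n"
    using set by (metis Suc_le_eq atLeastAtMost_iff list.set_intros(1))+
  have sf: "avoids_132_312 (map (up j) (f # L))"
  proof -
    have "avoids_1243_1423 (map (up j) (k # u))"
      using assms(3) avoids_1243_1423_map[OF strict_mono_up] by metis
    moreover have "map (up j) (k # u) = k # map (up j) u"
      using assms(4) by (simp add: up_def)
    ultimately show ?thesis
      using assms(2,4) by (simp add: avoids_1243_1423_Cons filter_map_up)
  qed
  have "avoids_132_312 (j # map (up j) (f # L)) \<longleftrightarrow> (\<forall>c\<in>set L. \<not> between (up j c) j (up j f))"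
    using dist sf
    by (subst list.map, subst avoids_132_312_Cons_Cons) (auto simp: distinct_map inj_up)
  also have "\<dots> \<longleftrightarrow> j = f \<or> j = Suc f"
  proof
    assume *: "\<forall>c\<in>set L. \<not> between (up j c) j (up j f)"
    show "j = f \<or> j = Suc f"
    proof (rule ccontr)
      assume ne: "\<not> (j = f \<or> j = Suc f)"
      show False
      proof (cases "j < f")
        case True
        then have "j \<in> set L"
          using L f assms(4) by auto
        then have "\<not> between (up j j) j (up j f)"
          using * by blast
        then show False
          using True by (simp add: between_def up_def)
      next
        case False
        then have "f < j - 1"
          using ne by linarith
        moreover have "k < j - 1" "j - 1 \<le> n"
          using f \<open>f < j - 1\<close> assms(5) by linarith+
        ultimately have "j - 1 \<in> set L"
          unfolding L by simp
        then have "\<not> between (up j (j - 1)) j (up j f)"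
          using * by blast
        moreover have "up j (j - 1) = j - 1" "up j f = f" "j - 1 < j"
          using \<open>f < j - 1\<close> by (simp_all add: up_def)
        ultimately show False
          using \<open>f < j - 1\<close> unfolding between_def by simp
      qed
    qed
  next
    assume "j = f \<or> j = Suc f"
    then show "\<forall>c\<in>set L. \<not> between (up j c) j (up j f)"
      by (auto simp: between_def up_def split: if_splits)
  qed
  finally show ?thesis
    using assms(2) by simp
qed

text \<open>No old letter lies above \<open>k = n\<close>, so there is no constraint, but the only value available for the
  new second letter is \<open>n + 1\<close>.\<close>

lemma card_ascent_tails_last:
  assumes "1 \<le> n"
  shows "card (ascent_tails (Suc n) n) = card (tails n n)"
proof -
  let ?ins = "\<lambda>u. Suc n # map (up (Suc n)) u"
  have nil: "filter (\<lambda>x. n < x) u = []" if "u \<in> tails n n" for u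
    using that by (auto simp: tails_def is_perm_def filter_empty_conv)
  have "ascent_tails (Suc n) n = ?ins ` tails n n"
  proof (intro equalityI subsetI)
    fix w assume "w \<in> ascent_tails (Suc n) n"
    then obtain j u where "w = j # map (up j) u" "n < j" "j \<le> Suc n" "u \<in> tails n n"
      using assms by (rule ascent_tailsE)
    then show "w \<in> ?ins ` tails n n"
      by (auto simp: le_Suc_eq)
  next
    fix w assume "w \<in> ?ins ` tails n n"
    then show "w \<in> ascent_tails (Suc n) n"
      using nil by (auto simp: ascent_tails_iff avoids_132_312_singleton)
  qed
  moreover have "inj_on ?ins (tails n n)"
    by (rule inj_onI) (auto dest: map_injective simp: inj_up)
  ultimately show ?thesis
    by (simp add: card_image)
qed

text \<open>The second letter can be deleted; conversely it can be put back in exactly two ways, directly below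
  or directly above the first of the letters greater than \<open>k\<close>. The bit \<open>e\<close> in the proof
  records the choice.\<close>

lemma card_ascent_tails:
  assumes "1 \<le> k" "k < n"
  shows "card (ascent_tails (Suc n) k) = 2 * card (tails n k)"
proof -
  define first where "first u = hd (filter (\<lambda>x. k < x) u)" for u
  define ins where "ins = (\<lambda>(u, e). (first u + e) # map (up (first u + e)) u)"
  have first: "\<exists>L. filter (\<lambda>x. k < x) u = first u # L" if "u \<in> tails n k" for u
  proof -
    have "Suc k \<in> set u"
    proof -
      have "Suc k \<in> set (k # u)"
        using that assms unfolding tails_def is_perm_def by auto
      then show ?thesis
        by simp
    qed
    then have "filter (\<lambda>x. k < x) u \<noteq> []"
      by (auto simp: filter_empty_conv)
    then show ?thesis
      unfolding first_def by (metis list.collapse)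
  qed
  have first_bounds: "k < first u" "first u \<le> n" if "u \<in> tails n k" for u
  proof -
    have "first u \<in> set (filter (\<lambda>x. k < x) u)"
      using first[OF that] by (metis list.set_intros(1))
    then show "k < first u" "first u \<le> n"
      using that by (auto simp: tails_def is_perm_def)
  qed
  have iff: "j # map (up j) u \<in> ascent_tails (Suc n) k \<longleftrightarrow> j = first u \<or> j = Suc (first u)"
    if "u \<in> tails n k" "k < j" "j \<le> Suc n" for u j
    using first[OF that(1)] that avoids_132_312_reinsert_iff[of n k u "first u" _ j]
    by (auto simp: ascent_tails_iff tails_def)
  have "ascent_tails (Suc n) k = ins ` (tails n k \<times> {0, 1})"
  proof (intro equalityI subsetI)
    fix w assume w: "w \<in> ascent_tails (Suc n) k"
    then obtain j u where ju: "w = j # map (up j) u" "k < j" "j \<le> Suc n" "u \<in> tails n k"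
      using ascent_tailsE[of w n k] assms by auto
    then have "j = first u \<or> j = Suc (first u)"
      using iff w by blast
    then have "w = ins (u, 0) \<or> w = ins (u, 1)"
      using ju by (auto simp: ins_def)
    then show "w \<in> ins ` (tails n k \<times> {0, 1})"
      using ju by blast
  next
    fix w assume "w \<in> ins ` (tails n k \<times> {0, 1})"
    then obtain u where u: "u \<in> tails n k" "w = ins (u, 0) \<or> w = ins (u, 1)"
      by auto
    then show "w \<in> ascent_tails (Suc n) k"
      using iff[OF u(1)] first_bounds[OF u(1)] by (auto simp: ins_def)
  qed
  moreover have "inj_on ins (tails n k \<times> {0, 1})"
  proof (rule inj_onI)
    fix x y assume "ins x = ins y"
    then show "x = y"
      by (cases x; cases y) (auto simp: ins_def dest!: map_injective[OF _ inj_up])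
  qed
  ultimately show ?thesis
    by (simp add: card_image card_cartesian_product)
qed

definition first_letter_count :: "nat \<Rightarrow> nat \<Rightarrow> nat" where
  "first_letter_count n k = card (tails n k)"

lemma first_letter_count_eq_0:
  "k = 0 \<or> n < k \<Longrightarrow> first_letter_count n k = 0"
proof -
  assume "k = 0 \<or> n < k"
  then have "k \<notin> {1..n}"
    by auto
  then have "tails n k = {}"
    by (auto simp: tails_def is_perm_def)
  then show ?thesis
    by (simp add: first_letter_count_def)
qed

lemma first_letter_count_1: "first_letter_count 1 1 = 1"
proof -
  have "tails 1 1 = {[]}"
  proof (intro equalityI subsetI)
    fix w assume "w \<in> tails 1 1"
    then have "x \<notin> set w" for x
      by (auto simp: tails_def is_perm_def)
    then show "w \<in> {[]}"
      by (cases w) auto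
  qed (auto simp: tails_def is_perm_def avoids_1243_1423_def)
  then show ?thesis
    by (simp add: first_letter_count_def)
qed

text \<open>The sum counts the avoiders whose second letter is smaller than \<open>k\<close>, the last term those whose
  second letter is larger. For \<open>k = n + 1\<close> the last term vanishes, as it should.\<close>

lemma first_letter_count_Suc:
  assumes "1 \<le> n" "1 \<le> k" "k \<le> Suc n"
  shows "first_letter_count (Suc n) k =
    (\<Sum>j\<in>{1..<k}. first_letter_count n j) + (if k = n then 1 else 2) * first_letter_count n k"
proof -
  \<comment> \<open>The second letter exists and differs from the first, so it is smaller or larger.\<close>
  have ne: "hd w \<noteq> k" if "w \<in> tails (Suc n) k" for w
  proof -
    have "w \<noteq> []"
    proof
      assume "w = []"
      then have "card {k} = card {1..Suc n}"
        using that by (simp add: tails_def is_perm_def)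
      then show False
        using assms by simp
    qed
    then show ?thesis
      using that by (auto simp: tails_def is_perm_def dest: hd_in_set)
  qed
  have "tails (Suc n) k = descent_tails (Suc n) k \<union> ascent_tails (Suc n) k"
    using ne by (force simp: descent_tails_def ascent_tails_def)
  moreover have "descent_tails (Suc n) k \<inter> ascent_tails (Suc n) k = {}"
    by (auto simp: descent_tails_def ascent_tails_def)
  moreover have "finite (descent_tails (Suc n) k)" "finite (ascent_tails (Suc n) k)"
    by (auto simp: descent_tails_def ascent_tails_def finite_tails)
  ultimately have "card (tails (Suc n) k) =
      card (descent_tails (Suc n) k) + card (ascent_tails (Suc n) k)"
    by (simp add: card_Un_disjoint)
  moreover have "card (ascent_tails (Suc n) k) = (if k = n then 1 else 2) * card (tails n k)"
  proof -
    consider "k < n" | "k = n" | "k = Suc n"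
      using assms by linarith
    then show ?thesis
    proof cases
      case 3
      have "ascent_tails (Suc n) k = {}"
        using ascent_tailsE[of _ n k] 3 assms by (metis all_not_in_conv not_less)
      then show ?thesis
        using 3 first_letter_count_eq_0[of k n] by (simp add: first_letter_count_def)
    qed (use assms card_ascent_tails card_ascent_tails_last in auto)
  qed
  ultimately show ?thesis
    using card_descent_tails[OF assms] by (simp add: first_letter_count_def)
qed

lemma avoiders_eq:
  "avoiders n [1, 2, 4, 3] [1, 4, 2, 3] = {\<pi>. is_perm n \<pi> \<and> avoids_1243_1423 \<pi>}"
  unfolding avoiders_def avoids_1243_1423_iff is_perm_def permutations_of_set_def by blast

lemma sum_avoiders:
  fixes g :: "nat \<Rightarrow> 'a :: comm_semiring_1"
  assumes "1 \<le> n"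
  shows "(\<Sum>\<pi>\<in>avoiders n [1, 2, 4, 3] [1, 4, 2, 3]. g (hd \<pi>)) =
    (\<Sum>k\<le>n. of_nat (first_letter_count n k) * g k)"
proof -
  have eq: "avoiders n [1, 2, 4, 3] [1, 4, 2, 3] = (\<Union>k\<le>n. (#) k ` tails n k)"
    unfolding avoiders_eq
  proof (intro equalityI subsetI)
    fix \<pi> assume "\<pi> \<in> {\<pi>. is_perm n \<pi> \<and> avoids_1243_1423 \<pi>}"
    then have \<pi>: "is_perm n \<pi>" "avoids_1243_1423 \<pi>"
      by auto
    obtain k w where kw: "\<pi> = k # w"
      using \<pi>(1) assms by (cases \<pi>) (auto simp: is_perm_def)
    have "k \<in> {1..n}"
      using \<pi>(1) kw by (auto simp: is_perm_def)
    with \<pi> kw show "\<pi> \<in> (\<Union>k\<le>n. (#) k ` tails n k)"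
      by (auto simp: tails_def)
  qed (auto simp: tails_def)
  have "(\<Sum>\<pi>\<in>avoiders n [1, 2, 4, 3] [1, 4, 2, 3]. g (hd \<pi>))
      = (\<Sum>k\<le>n. \<Sum>\<pi>\<in>(#) k ` tails n k. g (hd \<pi>))"
    unfolding eq by (rule sum.UNION_disjoint) (auto simp: finite_tails)
  also have "\<dots> = (\<Sum>k\<le>n. of_nat (first_letter_count n k) * g k)"
    by (intro sum.cong refl) (simp add: sum.reindex first_letter_count_def)
  finally show ?thesis .
qed

section \<open>Generating functions along the diagonals\<close>

text \<open>Write \<open>t\<close> for \<open>scaled_X c\<close>, that is \<open>c x\<close>. The parameter \<open>c\<close> keeps track of the first letter,
  and it becomes the indeterminate \<open>v\<close> at the end; having it in place from the start avoids a
  substitution in power series later on.\<close>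

definition scaled_X :: "'a :: field_char_0 \<Rightarrow> 'a fps" where
  "scaled_X c = fps_const c * fps_X"

definition schroeder_root :: "'a :: field_char_0 \<Rightarrow> 'a fps" where
  "schroeder_root c = fps_sqrt (1 - 6 * fps_const c * fps_X + fps_const c ^ 2 * fps_X ^ 2)"

text \<open>The generating function \<open>1 + t + 3 t\<^sup>2 + 11 t\<^sup>3 + \<dots>\<close> of the little Schroeder numbers,
  which is usually written \<open>(1 + t - R) / (4 t)\<close> with \<open>R\<close> the square root. The rationalised form
  needs no division by \<open>t\<close>.\<close>

definition little_schroeder :: "'a :: field_char_0 \<Rightarrow> 'a fps" where
  "little_schroeder c = 2 * inverse (1 + scaled_X c + schroeder_root c)"

text \<open>With \<open>\<eta>\<close> the little Schroeder series, this is \<open>E = t / (1 - t \<eta>)\<close> for \<open>d = 0\<close> and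
  \<open>2\<^bsup>d-1\<^esup> \<eta>\<^bsup>d\<^esup> E\<close> for \<open>d > 0\<close>. It turns out to count the avoiders with exactly \<open>d\<close> letters
  above the first one. The formula comes from the kernel method. With \<open>t = v x\<close> the kernel
  \<open>1 - v - 2 x + v x\<close>, multiplied by \<open>x\<close>, is a quadratic polynomial in \<open>x\<close> with roots \<open>t \<eta>\<close>
  and \<open>1 / (2 \<eta>)\<close>. Cancelling the first root leaves \<open>E (1 - x \<eta>) / (1 - 2 x \<eta>)\<close> for the
  whole generating function, and the formula is its coefficient of \<open>x\<^bsup>d\<^esup>\<close> for fixed
  \<open>t\<close>.\<close>

definition diagonal_gf :: "'a :: field_char_0 \<Rightarrow> nat \<Rightarrow> 'a fps" where
  "diagonal_gf c d = (if d = 0 then 1 else 2 ^ (d - 1) * little_schroeder c ^ d) *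
     (scaled_X c * inverse (1 - scaled_X c * little_schroeder c))"

lemma schroeder_root_square: "schroeder_root c ^ 2 = 1 - 6 * scaled_X c + scaled_X c ^ 2"
  unfolding schroeder_root_def scaled_X_def
  by (subst fps_sqrt) (simp_all add: power_mult_distrib mult.assoc power2_eq_square)

lemma schroeder_root_nth_0: "fps_nth (schroeder_root c) 0 = 1"
  unfolding schroeder_root_def by (rule fps_sqrt) (simp add: power2_eq_square)

lemma little_schroeder_mult: "little_schroeder c * (1 + scaled_X c + schroeder_root c) = 2"
proof -
  have "fps_nth (1 + scaled_X c + schroeder_root c) 0 \<noteq> 0"
    by (simp add: scaled_X_def schroeder_root_nth_0)
  then show ?thesis
    unfolding little_schroeder_def by (simp add: mult.assoc inverse_mult_eq_1)
qed

lemma little_schroeder_quadratic: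
  "(1 + scaled_X c) * little_schroeder c = 1 + 2 * scaled_X c * little_schroeder c ^ 2"
proof -
  define t \<eta> R where "t = scaled_X c" and "\<eta> = little_schroeder c" and "R = schroeder_root c"
  have "R * \<eta> = 2 - (1 + t) * \<eta>"
    using little_schroeder_mult[of c] unfolding t_def \<eta>_def R_def by (simp add: algebra_simps)
  then have "R ^ 2 * \<eta> ^ 2 = (2 - (1 + t) * \<eta>) ^ 2"
    by (metis power_mult_distrib)
  moreover have "R ^ 2 = 1 - 6 * t + t ^ 2"
    unfolding t_def R_def by (rule schroeder_root_square)
  ultimately have "4 * ((1 + t) * \<eta>) = 4 * (1 + 2 * t * \<eta> ^ 2)"
    by algebra
  then show ?thesis
    unfolding t_def[symmetric] \<eta>_def[symmetric] by (subst (asm) mult_cancel_left) auto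
qed

lemma schroeder_root_eq: "schroeder_root c = 1 + scaled_X c - 4 * scaled_X c * little_schroeder c"
proof -
  define t \<eta> R where "t = scaled_X c" and "\<eta> = little_schroeder c" and "R = schroeder_root c"
  have mult: "\<eta> * (1 + t + R) = 2" and quad: "(1 + t) * \<eta> = 1 + 2 * t * \<eta> ^ 2"
    unfolding t_def \<eta>_def R_def by (rule little_schroeder_mult little_schroeder_quadratic)+
  have "\<eta> * (1 + t - 4 * t * \<eta>) = (1 + t) * \<eta> - 2 * (1 + 2 * t * \<eta> ^ 2) + 2"
    by (simp add: algebra_simps power2_eq_square)
  also have "\<dots> = 2 - (1 + t) * \<eta>"
    unfolding quad[symmetric] by (simp add: algebra_simps)
  also have "\<dots> = \<eta> * R"
    unfolding mult[symmetric] by (simp add: algebra_simps)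
  finally have "\<eta> * R = \<eta> * (1 + t - 4 * t * \<eta>)" ..
  moreover have "\<eta> \<noteq> 0"
    using mult by auto
  ultimately show ?thesis
    unfolding t_def[symmetric] \<eta>_def[symmetric] R_def[symmetric]
    by (subst (asm) mult_cancel_left) auto
qed

lemma diagonal_gf_0_mult:
  "diagonal_gf c 0 * (1 - scaled_X c * little_schroeder c) = scaled_X c"
proof -
  have "fps_nth (1 - scaled_X c * little_schroeder c) 0 \<noteq> 0"
    by (simp add: scaled_X_def)
  then show ?thesis
    unfolding diagonal_gf_def by (simp add: mult.assoc inverse_mult_eq_1)
qed

lemma diagonal_gf_0_eq:
  "2 * diagonal_gf c 0 = scaled_X c * (3 - scaled_X c - schroeder_root c)"
proof -
  define t \<eta> E where "t = scaled_X c" and "\<eta> = little_schroeder c" and "E = diagonal_gf c 0"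
  have E: "E * (1 - t * \<eta>) = t" and quad: "(1 + t) * \<eta> = 1 + 2 * t * \<eta> ^ 2"
    unfolding t_def \<eta>_def E_def by (rule diagonal_gf_0_mult little_schroeder_quadratic)+
  have "fps_nth (1 - t * \<eta>) 0 \<noteq> 0"
    by (simp add: t_def scaled_X_def)
  then have "1 - t * \<eta> \<noteq> 0"
    by (metis fps_zero_nth)
  moreover have "2 * E * (1 - t * \<eta>) = t * (3 - t - (1 + t - 4 * t * \<eta>)) * (1 - t * \<eta>)"
  proof -
    have "(3 - t - (1 + t - 4 * t * \<eta>)) * (1 - t * \<eta>) =
        2 - 2 * t + 2 * t * ((1 + t) * \<eta> - 2 * t * \<eta> ^ 2)"
      by (simp add: algebra_simps power2_eq_square)
    also have "\<dots> = 2"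
      unfolding quad by simp
    finally have "t * (3 - t - (1 + t - 4 * t * \<eta>)) * (1 - t * \<eta>) = t * 2"
      by (simp only: mult.assoc)
    then show ?thesis
      using E by (simp add: mult.assoc)
  qed
  ultimately show ?thesis
    unfolding schroeder_root_eq t_def[symmetric] \<eta>_def[symmetric] E_def[symmetric]
    by (subst (asm) mult_cancel_right) auto
qed

lemma diagonal_gf_nth_0: "fps_nth (diagonal_gf c d) 0 = 0"
  by (simp add: diagonal_gf_def scaled_X_def)

lemma diagonal_gf_Suc: "diagonal_gf c (Suc d) = 2 ^ d * little_schroeder c ^ Suc d * diagonal_gf c 0"
  by (simp add: diagonal_gf_def)

text \<open>These relations between neighbouring diagonals mirror \<open>first_letter_count_difference\<close> below. All of
  them reduce to \<open>(1 + t) \<eta> = 1 + 2 t \<eta>\<^sup>2\<close> and \<open>E (1 - t \<eta>) = t\<close>; the first two differ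
  from the third because the factor \<open>2\<^bsup>d-1\<^esup>\<close> and the multiplicity in the recurrence start
  late.\<close>

lemma diagonal_gf_rec:
  "diagonal_gf c 0 = scaled_X c + scaled_X c * diagonal_gf c 1"
  "diagonal_gf c 1 + scaled_X c * diagonal_gf c 1 = scaled_X c * diagonal_gf c 2 + diagonal_gf c 0"
  "diagonal_gf c (Suc (Suc d)) + scaled_X c * diagonal_gf c (Suc (Suc d)) =
     scaled_X c * diagonal_gf c (Suc (Suc (Suc d))) + 2 * diagonal_gf c (Suc d)"
proof -
  define t \<eta> E where "t = scaled_X c" and "\<eta> = little_schroeder c" and "E = diagonal_gf c 0"
  have E: "E * (1 - t * \<eta>) = t" and quad: "(1 + t) * \<eta> = 1 + 2 * t * \<eta> ^ 2"
    unfolding t_def \<eta>_def E_def by (rule diagonal_gf_0_mult little_schroeder_quadratic)+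
  note F = diagonal_gf_Suc[of c, folded \<eta>_def E_def]
  show "diagonal_gf c 0 = scaled_X c + scaled_X c * diagonal_gf c 1"
    unfolding One_nat_def F E_def[symmetric] t_def[symmetric] using E
    by (simp add: algebra_simps)
  have "\<eta> * E + t * (\<eta> * E) = t * (2 * \<eta> ^ 2 * E) + E"
    using quad by algebra
  then show "diagonal_gf c 1 + scaled_X c * diagonal_gf c 1
      = scaled_X c * diagonal_gf c 2 + diagonal_gf c 0"
    unfolding One_nat_def numeral_2_eq_2 F E_def[symmetric] t_def[symmetric]
    by (simp add: numeral_2_eq_2)
  have "P * \<eta> ^ 2 + t * (P * \<eta> ^ 2) = t * (2 * P * \<eta> ^ 3) + P * \<eta>" for P
    using quad by algebra
  from this[of "2 * 2 ^ d * \<eta> ^ d * E"]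
  show "diagonal_gf c (Suc (Suc d)) + scaled_X c * diagonal_gf c (Suc (Suc d)) =
     scaled_X c * diagonal_gf c (Suc (Suc (Suc d))) + 2 * diagonal_gf c (Suc d)"
    unfolding F t_def[symmetric] by (simp add: power2_eq_square power3_eq_cube mult_ac)
qed

lemma scaled_X_mult_nth: "fps_nth (scaled_X c * f) (Suc k) = c * fps_nth f k"
  by (simp add: scaled_X_def mult.assoc)

text \<open>Subtracting \<open>first_letter_count_Suc\<close> for \<open>k\<close> from that for \<open>k + 1\<close> removes the sum.\<close>

lemma first_letter_count_difference:
  assumes "1 \<le> n" "k \<le> n"
  shows "first_letter_count (Suc n) (Suc k) + (if k = n then 1 else 2) * first_letter_count n k =
    first_letter_count (Suc n) k + first_letter_count n k +
    (if Suc k = n then 1 else 2) * first_letter_count n (Suc k)"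
proof (cases "k = 0")
  case True
  then show ?thesis
    using assms first_letter_count_Suc[of n "Suc k"] by (simp add: first_letter_count_eq_0)
next
  case False
  then have "{1..<Suc k} = insert k {1..<k}"
    by auto
  then show ?thesis
    using False assms first_letter_count_Suc[of n "Suc k"] first_letter_count_Suc[of n k] by simp
qed

lemma of_nat_first_letter_count_difference:
  assumes "1 \<le> n" "k \<le> n"
  shows "of_nat (first_letter_count (Suc n) (Suc k)) +
      (if k = n then 1 else 2) * of_nat (first_letter_count n k) =
    of_nat (first_letter_count (Suc n) k) + of_nat (first_letter_count n k) +
      (if Suc k = n then 1 else 2) * (of_nat (first_letter_count n (Suc k)) :: 'a :: field_char_0)"
  using arg_cong[OF first_letter_count_difference[OF assms], of "of_nat :: nat \<Rightarrow> 'a"]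
  by (simp only: of_nat_add of_nat_mult if_distrib[of of_nat] of_nat_1 of_nat_numeral)

text \<open>The local recurrence determines row \<open>n + 1\<close> of the triangle from row \<open>n\<close>, from left to right
  and starting with a zero in column 0, and the coefficients of the diagonal series obey the same
  recurrence. The case \<open>d = 0\<close> shows that the last entries of the rows have generating function
  \<open>E\<close>.\<close>

lemma first_letter_count_eq_diagonal_gf:
  fixes c :: "'a :: field_char_0"
  assumes "k + d = Suc n"
  shows "of_nat (first_letter_count (Suc n) k) * c ^ k = fps_nth (diagonal_gf c d) k"
  using assms
proof (induction n arbitrary: k d)
  case 0
  then consider "k = 0" | "k = 1" "d = 0"
    by linarith
  then show ?case
  proof cases
    case 1
    then show ?thesis
      by (simp add: first_letter_count_eq_0 diagonal_gf_nth_0)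
  next
    case 2
    have "fps_nth (diagonal_gf c 0) 1 = c"
      by (subst diagonal_gf_rec(1))
        (simp add: scaled_X_mult_nth[of _ _ 0, simplified] diagonal_gf_nth_0 scaled_X_def)
    then show ?thesis
      using 2 first_letter_count_1 by simp
  qed
next
  case (Suc n)
  let ?a = "\<lambda>n k. of_nat (first_letter_count n k) :: 'a"
  note IH = Suc.IH
  have diff: "?a (Suc (Suc n)) (Suc k) + (if k = Suc n then 1 else 2) * ?a (Suc n) k =
      ?a (Suc (Suc n)) k + ?a (Suc n) k + (if k = n then 1 else 2) * ?a (Suc n) (Suc k)"
    if "k \<le> Suc n" for k
    using of_nat_first_letter_count_difference[of "Suc n" k, where 'a = 'a] that by simp
  show ?case
    using Suc.prems
  proof (induction k arbitrary: d)
    case 0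
    then show ?case
      by (simp add: first_letter_count_eq_0 diagonal_gf_nth_0)
  next
    case (Suc k)
    have prev: "?a (Suc (Suc n)) k * c ^ k = fps_nth (diagonal_gf c (Suc d)) k"
      using Suc.IH[of "Suc d"] Suc.prems by simp
    have k: "k \<le> Suc n"
      using Suc.prems by simp
    \<comment> \<open>The difference recurrence, with the powers of \<open>c\<close> grouped as in the induction hypotheses.\<close>
    have eq: "?a (Suc (Suc n)) (Suc k) * c ^ Suc k +
        c * ((if d = 0 then 1 else 2) * (?a (Suc n) k * c ^ k)) =
        c * (?a (Suc (Suc n)) k * c ^ k) + c * (?a (Suc n) k * c ^ k) +
        (if d = 1 then 1 else 2) * (?a (Suc n) (Suc k) * c ^ Suc k)"
    proof -
      have "k = Suc n \<longleftrightarrow> d = 0" "k = n \<longleftrightarrow> d = 1"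
        using Suc.prems by auto
      then show ?thesis
        using arg_cong[OF diff[OF k], of "\<lambda>x. x * c ^ Suc k"] by (simp add: algebra_simps)
    qed
    have here: "?a (Suc n) k * c ^ k = fps_nth (diagonal_gf c d) k"
      using IH[of k d] Suc.prems by simp
    consider "d = 0" | "d = 1" | e where "d = Suc (Suc e)"
      by (metis One_nat_def old.nat.exhaust)
    then show ?case
    proof cases
      case 1
      then have "k = Suc n"
        using Suc.prems by simp
      then have "fps_nth (diagonal_gf c 0) (Suc k) = c * fps_nth (diagonal_gf c 1) k"
        by (subst diagonal_gf_rec(1)) (simp add: scaled_X_mult_nth, simp add: scaled_X_def)
      moreover have "?a (Suc n) (Suc k) = 0"
        using \<open>k = Suc n\<close> by (simp add: first_letter_count_eq_0)
      ultimately show ?thesis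
        using eq[unfolded prev here] 1 by simp
    next
      case 2
      have "?a (Suc n) (Suc k) * c ^ Suc k = fps_nth (diagonal_gf c 0) (Suc k)"
        using IH[of "Suc k" 0] Suc.prems 2 by simp
      then have "?a (Suc (Suc n)) (Suc k) * c ^ Suc k + c * fps_nth (diagonal_gf c 1) k =
          c * fps_nth (diagonal_gf c 2) k + fps_nth (diagonal_gf c 0) (Suc k)"
        using eq[unfolded prev here] 2 by (simp add: numeral_2_eq_2 algebra_simps)
      also have "\<dots> = fps_nth (diagonal_gf c 1) (Suc k) + c * fps_nth (diagonal_gf c 1) k"
        using arg_cong[OF diagonal_gf_rec(2)[of c], of "\<lambda>f. fps_nth f (Suc k)"]
        by (simp only: fps_add_nth scaled_X_mult_nth)
      finally show ?thesis
        using 2 by simp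
    next
      case 3
      have "?a (Suc n) (Suc k) * c ^ Suc k = fps_nth (diagonal_gf c (Suc e)) (Suc k)"
        using IH[of "Suc k" "Suc e"] Suc.prems 3 by simp
      then have "?a (Suc (Suc n)) (Suc k) * c ^ Suc k + c * fps_nth (diagonal_gf c (Suc (Suc e))) k =
          c * fps_nth (diagonal_gf c (Suc (Suc (Suc e)))) k +
          2 * fps_nth (diagonal_gf c (Suc e)) (Suc k)"
        using eq[unfolded prev here] 3 by (simp add: algebra_simps)
      also have "\<dots> = fps_nth (diagonal_gf c (Suc (Suc e))) (Suc k) +
          c * fps_nth (diagonal_gf c (Suc (Suc e))) k"
        using arg_cong[OF diagonal_gf_rec(3)[of c e], of "\<lambda>f. fps_nth f (Suc k)"]
        by (simp add: scaled_X_mult_nth numeral_fps_const)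
      finally show ?thesis
        using 3 by simp
    qed
  qed
qed

section \<open>The bivariate generating function\<close>

definition first_letter_poly :: "'a :: field_char_0 \<Rightarrow> nat \<Rightarrow> 'a" where
  "first_letter_poly c n = (\<Sum>k\<le>n. of_nat (first_letter_count n k) * c ^ k)"

text \<open>Multiplying the difference recurrence by \<open>c\<^bsup>k+1\<^esup>\<close> and summing over \<open>k\<close> telescopes.
  What remains on the right are the last entries of rows \<open>n + 1\<close> and \<open>n\<close>: the first is cut off by
  the telescoping, the second corrects for the multiplicity 1 in place of 2 at \<open>k = n\<close>.\<close>

lemma first_letter_poly_Suc:
  fixes c :: "'a :: field_char_0"
  assumes "1 \<le> n"
  shows "(1 - c) * first_letter_poly c (Suc n) - (2 - c) * first_letter_poly c n =
    - fps_nth (diagonal_gf c 0) (Suc n) * c - (c ^ n - c ^ Suc n) * of_nat (first_letter_count n n)"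
proof -
  let ?a = "\<lambda>n k. of_nat (first_letter_count n k) :: 'a"
  let ?m = "\<lambda>k. (if k = n then 1 else 2) :: 'a"
  have diff: "?a (Suc n) (Suc k) - ?a (Suc n) k = ?a n k - ?m k * ?a n k + ?m (Suc k) * ?a n (Suc k)"
    if "k \<le> n" for k
    using of_nat_first_letter_count_difference[of n k, where 'a = 'a] that assms
    by (simp only: algebra_simps)
  have m: "(\<Sum>k\<le>n. ?m k * (?a n k * z k)) = 2 * (\<Sum>k\<le>n. ?a n k * z k) - ?a n n * z n" for z
  proof -
    have "(\<Sum>k\<le>n. ?m k * (?a n k * z k)) =
        (\<Sum>k\<le>n. 2 * (?a n k * z k) - (if k = n then ?a n n * z n else 0))"
      by (rule sum.cong) auto
    then show ?thesis
      by (simp add: sum_subtractf sum_distrib_left)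
  qed
  \<comment> \<open>Shifting the index is free, as columns 0 and \<open>n + 1\<close> of row \<open>n\<close> vanish.\<close>
  have shift: "(\<Sum>k\<le>n. ?m (Suc k) * ?a n (Suc k) * c ^ Suc k) = (\<Sum>k\<le>n. ?m k * (?a n k * c ^ k))"
  proof -
    have "(\<Sum>k\<le>Suc n. ?m k * (?a n k * c ^ k)) =
        ?m 0 * ?a n 0 + (\<Sum>k\<le>n. ?m (Suc k) * (?a n (Suc k) * c ^ Suc k))"
      by (simp only: sum.atMost_Suc_shift) simp
    then show ?thesis
      by (simp add: first_letter_count_eq_0 mult.assoc)
  qed
  have "first_letter_poly c (Suc n) = (\<Sum>k\<le>n. ?a (Suc n) (Suc k) * c ^ Suc k)"
    unfolding first_letter_poly_def
    by (simp only: sum.atMost_Suc_shift) (simp add: first_letter_count_eq_0)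
  moreover have "c * first_letter_poly c (Suc n) =
      (\<Sum>k\<le>n. ?a (Suc n) k * c ^ Suc k) + c * (?a (Suc n) (Suc n) * c ^ Suc n)"
    unfolding first_letter_poly_def by (simp add: sum_distrib_left algebra_simps)
  ultimately have "(1 - c) * first_letter_poly c (Suc n) =
      (\<Sum>k\<le>n. (?a (Suc n) (Suc k) - ?a (Suc n) k) * c ^ Suc k) - c * (?a (Suc n) (Suc n) * c ^ Suc n)"
    by (simp add: left_diff_distrib sum_subtractf)
  also have "(\<Sum>k\<le>n. (?a (Suc n) (Suc k) - ?a (Suc n) k) * c ^ Suc k) =
      (\<Sum>k\<le>n. (?a n k - ?m k * ?a n k + ?m (Suc k) * ?a n (Suc k)) * c ^ Suc k)"
    by (intro sum.cong refl) (simp only: diff atMost_iff)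
  also have "\<dots> = c * (\<Sum>k\<le>n. ?a n k * c ^ k) - c * (\<Sum>k\<le>n. ?m k * (?a n k * c ^ k)) +
      (\<Sum>k\<le>n. ?m (Suc k) * ?a n (Suc k) * c ^ Suc k)"
    unfolding sum_distrib_left sum_subtractf[symmetric] sum.distrib[symmetric]
    by (intro sum.cong refl) (simp add: algebra_simps)
  also have "?a (Suc n) (Suc n) * c ^ Suc n = fps_nth (diagonal_gf c 0) (Suc n)"
    by (rule first_letter_count_eq_diagonal_gf) simp
  finally show ?thesis
    unfolding shift m first_letter_poly_def by (simp add: algebra_simps)
qed

text \<open>The recurrence for the row polynomials, read as an equation of power series. The only unknown on
  the right is the series of the last entries of the rows, which is already known to be \<open>E\<close>.\<close>

lemma kernel_equation:
  fixes c :: "'a :: field_char_0"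
  defines "G \<equiv> Abs_fps (first_letter_poly c)"
  defines "v \<equiv> fps_const c"
  shows "(1 - v - 2 * fps_X + v * fps_X) * G =
    v * fps_X - (v + fps_X - v * fps_X) * diagonal_gf c 0"
proof (rule fps_ext)
  fix n
  let ?E = "diagonal_gf c 0"
  have [simp]: "first_letter_poly c 0 = 0"
    by (simp add: first_letter_poly_def first_letter_count_eq_0)
  have E1: "fps_nth ?E (Suc 0) = c"
    using first_letter_count_eq_diagonal_gf[of 1 0 0 c] first_letter_count_1 by simp
  have G1: "first_letter_poly c (Suc 0) = c"
    using first_letter_count_1 by (simp add: first_letter_poly_def first_letter_count_eq_0)
  have lhs: "(1 - v - 2 * fps_X + v * fps_X) * G = (G - v * G) - fps_X * (2 * G - v * G)"
    by (simp add: algebra_simps)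
  have rhs: "v * fps_X - (v + fps_X - v * fps_X) * ?E = v * fps_X - v * ?E - fps_X * (?E - v * ?E)"
    by (simp add: algebra_simps)
  consider "n = 0" | "n = 1" | m where "n = Suc (Suc m)"
    by (metis One_nat_def old.nat.exhaust)
  then show "fps_nth ((1 - v - 2 * fps_X + v * fps_X) * G) n =
      fps_nth (v * fps_X - (v + fps_X - v * fps_X) * ?E) n"
  proof cases
    case 1
    then show ?thesis
      unfolding lhs rhs by (simp add: G_def v_def diagonal_gf_nth_0)
  next
    case 2
    then show ?thesis
      unfolding lhs rhs by (simp add: G_def v_def diagonal_gf_nth_0 E1 G1 numeral_fps_const)
  next
    case 3
    have "of_nat (first_letter_count (Suc m) (Suc m)) * c ^ Suc m = fps_nth ?E (Suc m)"
      by (rule first_letter_count_eq_diagonal_gf) simp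
    then show ?thesis
      unfolding lhs rhs using first_letter_poly_Suc[of "Suc m" c]
      by (simp add: G_def v_def 3 numeral_fps_const algebra_simps)
  qed
qed

lemma first_letter_gf_eq:
  "first_letter_gf [1, 2, 4, 3] [1, 4, 2, 3] = Abs_fps (first_letter_poly ratfun_v)"
proof (rule fps_ext)
  fix n show "fps_nth (first_letter_gf [1, 2, 4, 3] [1, 4, 2, 3]) n =
      fps_nth (Abs_fps (first_letter_poly ratfun_v)) n"
    using sum_avoiders[of n "\<lambda>k. ratfun_v ^ k"]
    by (cases n) (simp_all add: first_letter_gf_def first_letter_poly_def first_letter_count_eq_0)
qed

theorem corollary10:
  shows "first_letter_gf [1, 2, 4, 3] [1, 4, 2, 3] =
    (V * X * (2 - 3 * V - 3 * X + 3 * V * X)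
      + V * X * (V + X - V * X) * (V * X + fps_sqrt (1 - 6 * V * X + V ^ 2 * X ^ 2)))
    / (2 * (1 - V - 2 * X + V * X))"
proof -
  define E R where "E = diagonal_gf ratfun_v 0" and "R = fps_sqrt (1 - 6 * V * X + V ^ 2 * X ^ 2)"
  let ?G = "first_letter_gf [1, 2, 4, 3] [1, 4, 2, 3]"
  let ?D = "2 * (1 - V - 2 * X + V * X)"
  have kernel: "(1 - V - 2 * X + V * X) * ?G = V * X - (V + X - V * X) * E"
    unfolding first_letter_gf_eq E_def by (rule kernel_equation)
  have E: "2 * E = V * X * (3 - V * X - R)"
    using diagonal_gf_0_eq[of ratfun_v] unfolding E_def R_def scaled_X_def schroeder_root_def .
  have num: "V * X * (2 - 3 * V - 3 * X + 3 * V * X) + V * X * (V + X - V * X) * (V * X + R) = ?G * ?D"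
    using kernel E by algebra
  have "ratfun_v \<noteq> 1"
    unfolding ratfun_v_def to_fract_1[symmetric] to_fract_eq_iff by (simp add: one_pCons)
  then have "fps_nth ?D 0 \<noteq> 0"
    by (simp add: numeral_fps_const)
  then have "?D \<noteq> 0"
    by (metis fps_zero_nth)
  then show ?thesis
    unfolding R_def[symmetric] num by simp
qed

end
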